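(* Let $A\in\mathbb{Z}^{d\times n}$ be of full row-rank with $\operatorname{cone}(A)$ pointed. Let $D(A)$ denote the maximum absolute value of the determinants of the $d\times d$ submatrices of $A$, and let \[ M_F(A)=\Bigl(\max_{i=1,\ldots,d}\sum_{j=1}^n |A_{ij}|\Bigr)-1 . \] If the set $H$ of holes of the semigroup $Q$ generated by the columns of $A$ is finite, then \[ \|h\|_{\infty}\leq (d+1)\,M_F(A)^2\,D(A) \] holds for every $h\in H$.
   Context: Let $A\in\mathbb{Z}^{d\times n}$, and let $\mathbb{Z}_+$ denote the nonnegative integers. The semigroup generated by the columns of $A$ is $Q=\{A\lambda:\lambda\in\mathbb{Z}_+^n\}$. Let $\operatorname{cone}(A)=\{A\lambda:\lambda\in\mathbb{R}^n,\ \lambda\ge 0\}$ and $\operatorname{lattice}(A)=\{A\lambda:\lambda\in\mathbb{Z}^n\}$. The saturation of $Q$ is $Q_{\mathrm{sat}}=\operatorname{cone}(A)\cap\operatorname{lattice}(A)$. Standing assumption: $\operatorname{cone}(A)$ is pointed (contains no line). The set of holes of $Q$ is $H=Q_{\mathrm{sat}}\setminus Q$. $\|h\|_\infty$ is the maximum absolute value of the entries of $h$. *)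

theory Defs
  imports "HOL-Analysis.Analysis"
begin

text \<open>
  An integer matrix with \<open>d\<close> rows and \<open>n\<close> columns has type \<open>int ^ 'n ^ 'd\<close>. The cone, the lattice,
  the semigroup and the holes are all taken inside \<open>real ^ 'd\<close>, so that they can be intersected and
  subtracted as sets; integer coefficient vectors are real vectors with entries in \<open>\<nat>\<close> or \<open>\<int>\<close>.
\<close>

definition real_matrix :: "int ^ 'n ^ 'd \<Rightarrow> real ^ 'n ^ 'd" where
  "real_matrix A = map_matrix real_of_int A"

definition semigroup_of :: "int ^ 'n ^ 'd \<Rightarrow> (real ^ 'd) set" where
  "semigroup_of A = {real_matrix A *v l | l. \<forall>j. l $ j \<in> \<nat>}"

definition cone_of :: "int ^ 'n ^ 'd \<Rightarrow> (real ^ 'd) set" where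
  "cone_of A = {real_matrix A *v l | l. \<forall>j. 0 \<le> l $ j}"

definition lattice_of :: "int ^ 'n ^ 'd \<Rightarrow> (real ^ 'd) set" where
  "lattice_of A = {real_matrix A *v l | l. \<forall>j. l $ j \<in> \<int>}"

definition saturation :: "int ^ 'n ^ 'd \<Rightarrow> (real ^ 'd) set" where
  "saturation A = cone_of A \<inter> lattice_of A"

definition holes :: "int ^ 'n ^ 'd \<Rightarrow> (real ^ 'd) set" where
  "holes A = saturation A - semigroup_of A"

definition pointed :: "'a :: real_vector set \<Rightarrow> bool" where
  "pointed C \<longleftrightarrow> \<not> (\<exists>x v. v \<noteq> 0 \<and> (\<forall>t :: real. x + t *\<^sub>R v \<in> C))"

definition column_submatrix :: "int ^ 'n ^ 'd \<Rightarrow> ('d \<Rightarrow> 'n) \<Rightarrow> int ^ 'd ^ 'd" where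
  "column_submatrix A f = (\<chi> i k. A $ i $ f k)"

text \<open>
  The maximal square submatrices are indexed by the injections \<open>f\<close> from row to column indices. The
  order in which \<open>f\<close> lists the selected columns only affects the sign of the determinant. Such
  injections exist whenever the rows are linearly independent; otherwise the maximum may be over
  the empty set.
\<close>

definition max_minor :: "int ^ 'n ^ 'd \<Rightarrow> int" where
  "max_minor A = Max {\<bar>det (column_submatrix A f)\<bar> | f. inj f}"

definition M_F :: "int ^ 'n ^ 'd \<Rightarrow> int" where
  "M_F A = Max {\<Sum>j\<in>UNIV. \<bar>A $ i $ j\<bar> | i. True} - 1"

end

theory Submission
  imports Defs
begin

text \<open>
  The cone is generated by columns on its extreme rays, so a hole is \<open>h = (\<Sum>j\<in>J. c j *\<^sub>R a j)\<close> with
  \<open>c \<ge> 0\<close> and all \<open>a j\<close> extreme. Rounding the coefficients down leaves the hole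
  \<open>x = (\<Sum>j\<in>J. frac (c j) *\<^sub>R a j)\<close>. Since there are only finitely many holes,
  \<open>x + N *\<^sub>R a j\<close> lies in the semigroup for some \<open>N\<close>, and then \<open>c j < N\<close>, as otherwise \<open>h\<close>
  would lie in it too. To bound the least such \<open>N\<close>, take a vertex \<open>u\<close> of the polyhedron of functionals that
  are \<open>1\<close> on \<open>a j\<close> and nonpositive on all columns off its ray. By Cramer's rule its values
  on the columns are quotients of minors, and applying it to a representation of \<open>x + N *\<^sub>R a j\<close> gives
  \<open>N \<le> (t - 1) * D(A)\<close>, where \<open>t\<close> is the number of columns on which \<open>u\<close> does not vanish. Double
  counting the entries of \<open>A\<close> in the rows of the support of \<open>u\<close>, with \<open>r\<close> its size, gives
  \<open>t - 1 \<le> r * (M_F A - 1) + 1\<close>. Each entry of \<open>h\<close> is at most \<open>M_F A + 1\<close> times the largest \<open>c j\<close>.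
\<close>

section \<open>Finitely generated cones\<close>

text \<open>The generators are an indexed family, since columns of a matrix may repeat.
  Nonnegativity is asked for at every index, so later sums need no membership side
  conditions.\<close>

lemma convex_cone_hull_image:
  fixes a :: "'i \<Rightarrow> 'v::real_vector"
  assumes "finite J"
  shows "x \<in> convex_cone hull (a ` J) \<longleftrightarrow> (\<exists>c. (\<forall>j. 0 \<le> c j) \<and> x = (\<Sum>j\<in>J. c j *\<^sub>R a j))"
proof -
  let ?S = "{x. \<exists>c. (\<forall>j. 0 \<le> c j) \<and> x = (\<Sum>j\<in>J. c j *\<^sub>R a j)}"
  have "convex_cone hull (a ` J) = ?S"
  proof (rule hull_unique)
    show "a ` J \<subseteq> ?S"
    proof
      fix y assume "y \<in> a ` J"
      then obtain k where "k \<in> J" "y = a k" by blast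
      then have "y = (\<Sum>j\<in>J. (if j = k then 1 else 0) *\<^sub>R a j)"
        using assms by (simp add: if_distrib[of "\<lambda>r. r *\<^sub>R _"] sum.delta cong: if_cong)
      then show "y \<in> ?S"
        by (intro CollectI exI[of _ "\<lambda>j. if j = k then 1 else 0"] conjI) auto
    qed
    have "\<exists>c. (\<forall>j. 0 \<le> c j) \<and> 0 = (\<Sum>j\<in>J. c j *\<^sub>R a j)"
      by (rule exI[of _ "\<lambda>_. 0"]) simp
    moreover have "\<exists>e. (\<forall>j. 0 \<le> e j) \<and>
        (\<Sum>j\<in>J. c j *\<^sub>R a j) + (\<Sum>j\<in>J. d j *\<^sub>R a j) = (\<Sum>j\<in>J. e j *\<^sub>R a j)"
      if "\<forall>j. 0 \<le> c j" "\<forall>j. 0 \<le> d j" for c d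
      using that by (intro exI[of _ "\<lambda>j. c j + d j"]) (simp add: scaleR_add_left sum.distrib)
    moreover have "\<exists>e. (\<forall>j. 0 \<le> e j) \<and> r *\<^sub>R (\<Sum>j\<in>J. c j *\<^sub>R a j) = (\<Sum>j\<in>J. e j *\<^sub>R a j)"
      if "\<forall>j. 0 \<le> c j" "0 \<le> r" for c r
      using that by (intro exI[of _ "\<lambda>j. r * c j"]) (simp add: scaleR_sum_right)
    ultimately show "convex_cone ?S"
      unfolding convex_cone_iff by blast
    fix T assume T: "a ` J \<subseteq> T" "convex_cone T"
    show "?S \<subseteq> T"
    proof clarify
      fix c :: "'i \<Rightarrow> real" assume c: "\<forall>j. 0 \<le> c j"
      have "K \<subseteq> J \<Longrightarrow> (\<Sum>j\<in>K. c j *\<^sub>R a j) \<in> T" if "finite K" for K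
        using that
      proof (induction K)
        case empty
        then show ?case using T(2) by (simp add: convex_cone_contains_0)
      next
        case (insert k K)
        then show ?case
          using T c by (auto intro!: convex_cone_add convex_cone_scaleR)
      qed
      then show "(\<Sum>j\<in>J. c j *\<^sub>R a j) \<in> T" using assms by blast
    qed
  qed
  then show ?thesis by auto
qed

section \<open>Pointed cones, extreme generators and separating functionals\<close>

lemma pointed_convex_cone:
  assumes "pointed C" "convex_cone C" "v \<in> C" "- v \<in> C"
  shows "v = 0"
proof (rule ccontr)
  assume "v \<noteq> 0"
  have "0 + t *\<^sub>R v \<in> C" for t :: real
  proof (cases "0 \<le> t")
    case True
    then show ?thesis using assms by (simp add: convex_cone_scaleR)
  next
    case False
    then have "(- t) *\<^sub>R (- v) \<in> C" using assms by (intro convex_cone_scaleR) auto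
    then show ?thesis by simp
  qed
  then show False using assms(1) \<open>v \<noteq> 0\<close> unfolding pointed_def by blast
qed

lemma convex_cone_sum_mem:
  assumes "convex_cone C" "\<And>k. k \<in> K \<Longrightarrow> f k \<in> C"
  shows "sum f K \<in> C"
  using assms(2)
  by (induction K rule: infinite_finite_induct)
    (auto simp: convex_cone_contains_0[OF assms(1)] intro: convex_cone_add[OF assms(1)])

text \<open>\<open>J\<close> is a generating index set of least cardinality, so no
  \<open>a j\<close> with \<open>j\<close> in \<open>J\<close> lies in the cone \<open>?H\<close> of
  the other generators. Given a representation of \<open>a j\<close> by columns off its open ray,
  each of these columns is split into a multiple of \<open>a j\<close> and an element of
  \<open>?H\<close>, which yields \<open>a j = s *\<^sub>R a j + z\<close> with \<open>z\<close> in
  \<open>?H\<close>.\<close>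

lemma pointed_cone_extreme_generators:
  fixes a :: "'n::finite \<Rightarrow> 'v::real_vector"
  assumes "pointed (convex_cone hull (range a))"
  obtains J where "convex_cone hull (a ` J) = convex_cone hull (range a)"
    and "\<And>j. j \<in> J \<Longrightarrow> a j \<notin> convex_cone hull (a ` {k. \<not> (\<exists>t>0. a k = t *\<^sub>R a j)})"
proof -
  let ?C = "convex_cone hull (range a)"
  let ?P = "\<lambda>J. convex_cone hull (a ` J) = ?C"
  have "\<exists>J. ?P J \<and> (\<forall>J'. ?P J' \<longrightarrow> card J \<le> card J')"
    using ex_has_least_nat[of ?P UNIV card] by simp
  then obtain J where J: "?P J" and min: "\<And>J'. ?P J' \<Longrightarrow> card J \<le> card J'" by blast
  have C: "convex_cone ?C" by (rule convex_cone_convex_cone_hull)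
  have "a j \<notin> convex_cone hull (a ` {k. \<not> (\<exists>t>0. a k = t *\<^sub>R a j)})" (is "_ \<notin> convex_cone hull (a ` ?K)")
    if j: "j \<in> J" for j
  proof
    let ?H = "convex_cone hull (a ` (J - {j}))"
    have H: "convex_cone ?H" by (rule convex_cone_convex_cone_hull)
    have HC: "?H \<subseteq> ?C" by (intro hull_mono) auto
    have aC: "a k \<in> ?C" for k by (intro hull_inc) auto
    have nH: "a j \<notin> ?H"
    proof
      assume "a j \<in> ?H"
      then have "a ` J \<subseteq> ?H" using hull_subset[of "a ` (J - {j})" convex_cone] by auto
      then have "convex_cone hull (a ` J) \<subseteq> ?H" by (intro hull_minimal H)
      then have "?P (J - {j})" using J HC by auto
      then show False using min[of "J - {j}"] j by (meson card_Diff1_less finite linorder_not_less)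
    qed
    then have aj0: "a j \<noteq> 0" using convex_cone_contains_0[OF H] by auto
    assume "a j \<in> convex_cone hull (a ` ?K)"
    then obtain l where l: "\<And>k. 0 \<le> l k" and al: "a j = (\<Sum>k\<in>?K. l k *\<^sub>R a k)"
      using convex_cone_hull_image[of ?K "a j" a] by auto
    have "\<exists>x y. 0 \<le> x \<and> y \<in> ?H \<and> a k = x *\<^sub>R a j + y" for k
    proof -
      have "a k \<in> convex_cone hull (a ` J)" using J aC by simp
      then obtain c where c: "\<forall>i. 0 \<le> c i" "a k = (\<Sum>i\<in>J. c i *\<^sub>R a i)"
        using convex_cone_hull_image[of J "a k" a] by auto
      have "(\<Sum>i\<in>J - {j}. c i *\<^sub>R a i) \<in> ?H"
        using c(1) convex_cone_hull_image[of "J - {j}" _ a] by auto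
      moreover have "a k = c j *\<^sub>R a j + (\<Sum>i\<in>J - {j}. c i *\<^sub>R a i)"
        using c(2) j by (simp add: sum.remove[of J j])
      ultimately show ?thesis using c(1) by blast
    qed
    then obtain x y where x: "\<And>k. 0 \<le> x k" and y: "\<And>k. y k \<in> ?H"
      and xy: "\<And>k. a k = x k *\<^sub>R a j + y k" by metis
    define s where "s = (\<Sum>k\<in>?K. l k * x k)"
    define z where "z = (\<Sum>k\<in>?K. l k *\<^sub>R y k)"
    have zH: "z \<in> ?H" unfolding z_def using l y by (intro convex_cone_sum_mem H convex_cone_scaleR)
    have "a j = (\<Sum>k\<in>?K. (l k * x k) *\<^sub>R a j + l k *\<^sub>R y k)"
      by (subst al, rule sum.cong[OF refl], subst xy, simp add: scaleR_add_right)
    then have ajz: "a j = s *\<^sub>R a j + z"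
      by (simp add: sum.distrib s_def z_def flip: scaleR_sum_left)
    show False
    \<comment> \<open>For \<open>s < 1\<close> the equation solves for \<open>a j\<close> inside
      \<open>?H\<close>, against minimality. Otherwise \<open>z\<close> and \<open>- z\<close> both
      lie in the cone, so pointedness gives \<open>z = 0\<close>.\<close>
    proof (cases "s < 1")
      case True
      have "z = (1 - s) *\<^sub>R a j" using ajz by (simp add: algebra_simps)
      then have "a j = (1 / (1 - s)) *\<^sub>R z" using True by auto
      moreover have "(1 / (1 - s)) *\<^sub>R z \<in> ?H" using True zH by (intro convex_cone_scaleR H) auto
      ultimately show False using nH by simp
    next
      case False
      have zs: "z = - ((s - 1) *\<^sub>R a j)" using ajz by (simp add: algebra_simps)
      have "(s - 1) *\<^sub>R a j \<in> ?C" using False aC by (intro convex_cone_scaleR C) auto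
      moreover have "- ((s - 1) *\<^sub>R a j) \<in> ?C" using zs zH HC by auto
      ultimately have "(s - 1) *\<^sub>R a j = 0" using pointed_convex_cone[OF assms C] by blast
      then have z0: "z = 0" using zs by simp
      \<comment> \<open>Pointedness again makes every summand of \<open>z\<close> vanish. If
        \<open>y k = 0\<close>, then \<open>a k = x k *\<^sub>R a j\<close>, and \<open>k\<close>
        being off the open ray leaves only \<open>x k = 0\<close>.\<close>
      have "l k *\<^sub>R a k = 0" if k: "k \<in> ?K" for k
      proof -
        have "l k *\<^sub>R y k + (\<Sum>i\<in>?K - {k}. l i *\<^sub>R y i) = z"
          unfolding z_def by (rule sum.remove[symmetric]) (use k in auto)
        then have "l k *\<^sub>R y k + (\<Sum>i\<in>?K - {k}. l i *\<^sub>R y i) = 0" using z0 by simp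
        then have "- (l k *\<^sub>R y k) = (\<Sum>i\<in>?K - {k}. l i *\<^sub>R y i)"
          by (rule minus_unique)
        also have "\<dots> \<in> ?C" using l y HC by (intro convex_cone_sum_mem C convex_cone_scaleR) auto
        finally have "l k *\<^sub>R y k = 0"
          using l y HC by (intro pointed_convex_cone[OF assms C] convex_cone_scaleR[OF C]) auto
        moreover have "x k = 0" if "y k = 0"
          using xy[of k] x[of k] k that by (auto simp: less_le)
        ultimately show ?thesis using xy[of k] by auto
      qed
      then have "a j = 0" by (subst al) (rule sum.neutral, blast)
      then show False using aj0 by blast
    qed
  qed
  then show thesis using J that by blast
qed

text \<open>A finitely generated cone is closed, so a hyperplane strictly separates \<open>p\<close>
  from it. A generator on the negative side could be scaled until it reaches the level
  \<open>b\<close>, so there is none; dividing by the negative number \<open>v \<bullet> p\<close>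
  normalises the value at \<open>p\<close> and flips the signs.\<close>

lemma convex_cone_hull_separation:
  fixes p :: "'v::euclidean_space"
  assumes "finite X" "p \<notin> convex_cone hull X"
  obtains u where "u \<bullet> p = 1" "\<And>x. x \<in> X \<Longrightarrow> u \<bullet> x \<le> 0"
proof -
  let ?C = "convex_cone hull X"
  have C: "convex_cone ?C" by (rule convex_cone_convex_cone_hull)
  obtain v b where v: "v \<bullet> p < b" "\<And>x. x \<in> ?C \<Longrightarrow> v \<bullet> x > b"
    using separating_hyperplane_closed_point[OF convex_convex_cone_hull closed_convex_cone_hull assms(2)]
      assms(1) by blast
  have b: "b < 0" using v(2)[OF convex_cone_contains_0[OF C]] by simp
  have nn: "v \<bullet> x \<ge> 0" if "x \<in> X" for x
  proof (rule ccontr)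
    assume neg: "\<not> v \<bullet> x \<ge> 0"
    have "(b / (v \<bullet> x)) *\<^sub>R x \<in> ?C"
      using neg b that by (intro convex_cone_scaleR C hull_inc) (auto simp: divide_nonpos_neg)
    then have "v \<bullet> ((b / (v \<bullet> x)) *\<^sub>R x) > b" by (rule v(2))
    then show False using neg by simp
  qed
  have neg: "v \<bullet> p < 0" using v(1) b by simp
  show thesis
  proof (rule that[of "(1 / (v \<bullet> p)) *\<^sub>R v"])
    show "(1 / (v \<bullet> p)) *\<^sub>R v \<bullet> p = 1" using neg by simp
    show "(1 / (v \<bullet> p)) *\<^sub>R v \<bullet> x \<le> 0" if "x \<in> X" for x
      using neg nn[OF that] by (simp add: divide_nonneg_neg)
  qed
qed

text \<open>A solution of the system with as many tight inequalities as possible is a vertex: otherwise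
  it can be moved orthogonally to the tight vectors until another inequality becomes tight.\<close>

lemma separation_vertex:
  fixes a :: "'n::finite \<Rightarrow> 'v::euclidean_space"
  assumes span: "span (range a) = UNIV"
    and K: "\<And>k. k \<notin> K \<Longrightarrow> a k \<in> span {p}"
    and p: "p \<notin> convex_cone hull (a ` K)"
  obtains u where "u \<bullet> p = 1" "\<And>k. k \<in> K \<Longrightarrow> u \<bullet> a k \<le> 0"
    "span (insert p (a ` {k \<in> K. u \<bullet> a k = 0})) = UNIV"
proof -
  let ?P = "\<lambda>u. u \<bullet> p = 1 \<and> (\<forall>k\<in>K. u \<bullet> a k \<le> 0)"
  let ?T = "\<lambda>u. {k \<in> K. u \<bullet> a k = 0}"
  obtain u0 where "?P u0"
    using convex_cone_hull_separation[of "a ` K" p] p by (metis finite imageI finite_imageI)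
  moreover have "\<forall>u. ?P u \<longrightarrow> card (?T u) < Suc CARD('n)"
    by (simp add: card_mono less_Suc_eq_le)
  ultimately have "\<exists>u. ?P u \<and> (\<forall>w. ?P w \<longrightarrow> card (?T w) \<le> card (?T u))"
    by (rule ex_has_greatest_nat[of ?P u0 "\<lambda>u. card (?T u)"])
  then obtain u where u: "?P u" and max: "\<And>w. ?P w \<Longrightarrow> card (?T w) \<le> card (?T u)"
    by (elim exE conjE) (rule that, auto)
  have "span (insert p (a ` ?T u)) = UNIV"
  proof (rule ccontr)
    assume "span (insert p (a ` ?T u)) \<noteq> UNIV"
    then obtain w0 where w0: "w0 \<noteq> 0" "\<forall>x\<in>span (insert p (a ` ?T u)). w0 \<bullet> x = 0"
      using span_not_UNIV_orthogonal by blast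
    have "\<exists>k. w0 \<bullet> a k \<noteq> 0"
    proof (rule ccontr)
      assume no: "\<not> (\<exists>k. w0 \<bullet> a k \<noteq> 0)"
      have "orthogonal w0 x" if "x \<in> span (range a)" for x
        using that by (rule orthogonal_to_span) (use no in \<open>auto simp: orthogonal_def\<close>)
      then have "w0 \<bullet> w0 = 0" unfolding span orthogonal_def by blast
      then show False using w0(1) by simp
    qed
    then obtain k0 where k0: "w0 \<bullet> a k0 \<noteq> 0" by blast
    \<comment> \<open>The factor fixes the sign: \<open>w \<bullet> a k0\<close> is positive, so
      moving along \<open>w\<close> must eventually make an inequality tight.\<close>
    define w where "w = (w0 \<bullet> a k0) *\<^sub>R w0"
    have w: "w \<bullet> x = 0" if "x \<in> span (insert p (a ` ?T u))" for x
      using w0(2) that by (simp add: w_def)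
    have wp: "w \<bullet> p = 0" by (intro w span_base) auto
    have wT: "w \<bullet> a k = 0" if "k \<in> ?T u" for k using that by (intro w span_base) auto
    have wK: "w \<bullet> a k = 0" if "k \<notin> K" for k
      using K[OF that] span_mono[of "{p}" "insert p (a ` ?T u)"] by (intro w) blast
    define S where "S = {k. 0 < w \<bullet> a k}"
    have "k0 \<in> S" using k0 by (auto simp: S_def w_def power2_eq_square[symmetric])
    then have "S \<noteq> {}" by blast
    \<comment> \<open>The step length along \<open>w\<close> at which the inequality of
      \<open>k\<close> becomes tight. The least one, \<open>m\<close>, is the longest step that
      violates no inequality.\<close>
    define r where "r = (\<lambda>k. - (u \<bullet> a k) / (w \<bullet> a k))"
    define m where "m = Min (r ` S)"
    have "m \<in> r ` S" unfolding m_def using \<open>S \<noteq> {}\<close> by (intro Min_in) auto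
    then obtain k1 where k1: "k1 \<in> S" "m = r k1" by blast
    have SK: "S \<subseteq> K" using wK unfolding S_def by (metis (lifting) less_irrefl mem_Collect_eq subsetI)
    have mle: "m \<le> r k" if "k \<in> S" for k unfolding m_def using that by (intro Min_le) auto
    have "u \<bullet> a k1 \<le> 0" using k1(1) SK u by blast
    then have "m \<ge> 0" using k1 by (auto simp: r_def S_def divide_nonpos_pos)
    define v where "v = u + m *\<^sub>R w"
    have va: "v \<bullet> a k = u \<bullet> a k + m * (w \<bullet> a k)" for k by (simp add: v_def inner_add_left)
    have "v \<bullet> p = 1" using u wp by (simp add: v_def inner_add_left)
    moreover have "v \<bullet> a k \<le> 0" if k: "k \<in> K" for k
    proof (cases "k \<in> S")
      case True
      then have "m * (w \<bullet> a k) \<le> r k * (w \<bullet> a k)"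
        using mle[OF True] by (intro mult_right_mono) (auto simp: S_def)
      also have "\<dots> = - (u \<bullet> a k)" using True by (auto simp: r_def S_def)
      finally show ?thesis using va by simp
    next
      case False
      then have "m * (w \<bullet> a k) \<le> 0" using \<open>m \<ge> 0\<close> by (intro mult_nonneg_nonpos) (auto simp: S_def)
      moreover have "u \<bullet> a k \<le> 0" using u k by blast
      ultimately show ?thesis using va[of k] by linarith
    qed
    ultimately have "?P v" by blast
    have "v \<bullet> a k1 = 0" using k1 by (simp add: va r_def S_def)
    moreover have "k1 \<notin> ?T u" using wT k1 by (auto simp: S_def)
    ultimately have "insert k1 (?T u) \<subseteq> ?T v" using wT va k1 SK by auto
    then have "card (insert k1 (?T u)) \<le> card (?T v)" by (intro card_mono) auto
    then have "card (?T u) < card (?T v)" using \<open>k1 \<notin> ?T u\<close> by simp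
    then show False using max[OF \<open>?P v\<close>] by simp
  qed
  then show thesis using that u by blast
qed

section \<open>Bases of columns and minors\<close>

text \<open>Extending \<open>a j0\<close> to a basis inside the spanning set gives exactly as many
  columns as there are rows, so row indices can enumerate them and a square minor arises. The place
  \<open>k0\<close> of \<open>j0\<close> is marked for later column exchanges.\<close>

lemma spanning_family_basis:
  fixes a :: "'n \<Rightarrow> real ^ 'd"
  assumes span: "span (insert (a j0) (a ` T)) = UNIV" and nz: "a j0 \<noteq> 0"
  obtains f :: "'d \<Rightarrow> 'n" and k0 where "f k0 = j0" "\<And>k. k \<noteq> k0 \<Longrightarrow> f k \<in> T"
    "det (\<chi> i k. a (f k) $ i) \<noteq> 0"
proof -
  obtain B where B: "{a j0} \<subseteq> B" "B \<subseteq> insert (a j0) (a ` T)" "independent B"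
    "insert (a j0) (a ` T) \<subseteq> span B"
    using maximal_independent_subset_extend[of "{a j0}" "insert (a j0) (a ` T)"] nz
    by (metis insert_subset empty_subsetI insertI1 independent_insert independent_empty span_empty singletonD
        insert_absorb2)
  have sB: "span B = UNIV" using B(4) span span_minimal[OF _ subspace_span] by blast
  have "card B = CARD('d)"
    using dim_eq_card_independent[OF B(3)] sB by (metis DIM_cart DIM_real dim_UNIV dim_span mult.right_neutral)
  moreover have "finite B" using B(3) by (rule independent_imp_finite)
  ultimately obtain g where g: "bij_betw g (UNIV :: 'd set) B"
    using finite_same_card_bij[of "UNIV :: 'd set" B] by auto
  then obtain k0 where k0: "g k0 = a j0" using B(1) unfolding bij_betw_def by auto
  have "\<exists>j\<in>T. a j = g k" if "k \<noteq> k0" for k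
  proof -
    have "g k \<in> B" "g k \<noteq> g k0" using g that unfolding bij_betw_def inj_def by auto
    then have "g k \<in> a ` T" using B(2) k0 by auto
    then show ?thesis by (metis imageE)
  qed
  then obtain f' where f': "\<And>k. k \<noteq> k0 \<Longrightarrow> f' k \<in> T \<and> a (f' k) = g k" by metis
  define f where "f = f'(k0 := j0)"
  have af: "a (f k) = g k" for k using f' k0 by (simp add: f_def)
  let ?M = "\<chi> i k. a (f k) $ i"
  have "column k ?M = g k" for k by (simp add: column_def af vec_eq_iff)
  then have "columns ?M = B" using g unfolding columns_def bij_betw_def by auto
  then have "invertible ?M"
    using sB matrix_right_invertible_span_columns[of ?M] by (simp add: span_vec_eq invertible_right_inverse)
  then have "det ?M \<noteq> 0" by (simp add: invertible_det_nz)
  then show thesis using that[of f k0] f' by (simp add: f_def)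
qed

text \<open>By the assumptions on \<open>u\<close>, pairing with \<open>u\<close> reads off the
  coordinate of \<open>a j\<close> at \<open>k0\<close> in the basis given by \<open>f\<close>.
  Cramer's rule says that this coordinate is the quotient of the two determinants.\<close>

lemma det_replace_column:
  fixes a :: "'n \<Rightarrow> real ^ 'd"
  assumes f: "u \<bullet> a (f k0) = 1" "\<And>k. k \<noteq> k0 \<Longrightarrow> u \<bullet> a (f k) = 0"
    and d: "det (\<chi> i k. a (f k) $ i) \<noteq> 0"
  shows "det (\<chi> i k. a ((f(k0 := j)) k) $ i) = (u \<bullet> a j) * det (\<chi> i k. a (f k) $ i)"
proof -
  let ?B = "\<chi> i k. a (f k) $ i"
  have "invertible ?B" using d by (simp add: invertible_det_nz)
  then have "surj ((*v) ?B)"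
    by (simp add: invertible_right_inverse matrix_right_invertible_surjective)
  then obtain y where y: "a j = ?B *v y" by (metis surjD)
  have "a j = (\<Sum>k\<in>UNIV. y $ k *\<^sub>R a (f k))"
    unfolding y by (simp add: matrix_mult_sum column_def vec_eq_iff)
  then have "u \<bullet> a j = (\<Sum>k\<in>UNIV. y $ k * (u \<bullet> a (f k)))"
    by (simp add: inner_sum_right)
  also have "\<dots> = y $ k0"
    using f by (subst sum.remove[of UNIV k0]) auto
  finally have uy: "u \<bullet> a j = y $ k0" .
  have "(\<chi> i k. a ((f(k0 := j)) k) $ i) = (\<chi> i k. if k = k0 then (?B *v y) $ i else ?B $ i $ k)"
    by (simp add: vec_eq_iff flip: y)
  then show ?thesis using cramer_lemma[of k0 ?B y] uy by simp
qed

text \<open>The transpose of \<open>B\<close> maps the vectors supported on \<open>R\<close>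
  injectively into the vectors supported on the columns that meet \<open>R\<close>; compare
  dimensions.\<close>

lemma card_support_le:
  fixes B :: "real ^ 'd ^ 'd"
  assumes "det B \<noteq> 0"
  shows "card R \<le> card {k. \<exists>i\<in>R. B $ i $ k \<noteq> 0}"
proof -
  let ?X = "{x :: real ^ 'd. \<forall>i. i \<notin> R \<longrightarrow> x $ i = 0}"
  let ?K = "{k. \<exists>i\<in>R. B $ i $ k \<noteq> 0}"
  let ?Y = "{x :: real ^ 'd. \<forall>i. i \<notin> ?K \<longrightarrow> x $ i = 0}"
  have dim: "dim {x :: real ^ 'd. \<forall>i. i \<notin> I \<longrightarrow> x $ i = 0} = card I" for I
    using dim_substandard_cart[of I, where 'a = real] by (simp add: dim_vec_eq)
  have "invertible (transpose B)" using assms by (simp add: invertible_det_nz det_transpose)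
  then have "inj ((*v) (transpose B))"
    by (simp add: invertible_left_inverse matrix_left_invertible_injective)
  then have "dim ((*v) (transpose B) ` ?X) = dim ?X"
    by (intro dim_image_eq matrix_vector_mul_linear) (auto intro: inj_on_subset)
  moreover have "(*v) (transpose B) ` ?X \<subseteq> ?Y"
  proof (intro image_subsetI CollectI allI impI)
    fix x k assume x: "x \<in> ?X" and k: "k \<notin> ?K"
    have "B $ i $ k * x $ i = 0" for i using x k by (cases "i \<in> R") auto
    then have "(\<Sum>i\<in>UNIV. B $ i $ k * x $ i) = 0" by (intro sum.neutral) blast
    then show "(transpose B *v x) $ k = 0" by (simp add: matrix_vector_mult_def transpose_def)
  qed
  then have "dim ((*v) (transpose B) ` ?X) \<le> dim ?Y" by (rule dim_subset)
  ultimately show ?thesis unfolding dim by simp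
qed

text \<open>A basis column other than \<open>f p\<close> that meets the support of \<open>u\<close> is orthogonal to \<open>u\<close>, hence has
  two nonzero entries in the rows of this support, while a column with \<open>u \<bullet> a \<noteq> 0\<close> has at least one.\<close>

lemma card_nonorthogonal_columns:
  fixes A :: "int ^ 'n ^ 'd"
  defines "a \<equiv> \<lambda>j. column j (real_matrix A)"
  assumes S: "\<And>i. (\<Sum>j\<in>UNIV. \<bar>A $ i $ j\<bar>) \<le> S"
    and f: "\<And>k. k \<noteq> p \<Longrightarrow> u \<bullet> a (f k) = 0"
    and d: "det (\<chi> i k. a (f k) $ i) \<noteq> 0"
  shows "int (card {j. u \<bullet> a j \<noteq> 0}) + 2 * int (card {i. u $ i \<noteq> 0}) \<le> int (card {i. u $ i \<noteq> 0}) * S + 2"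
proof -
  let ?R = "{i. u $ i \<noteq> 0}" and ?T = "{j. u \<bullet> a j \<noteq> 0}"
  let ?B = "\<chi> i k. a (f k) $ i"
  let ?K = "{k. \<exists>i\<in>?R. ?B $ i $ k \<noteq> 0}"
  define w where "w j = (\<Sum>i\<in>?R. \<bar>A $ i $ j\<bar>)" for j
  have a: "a j $ i = real_of_int (A $ i $ j)" for i j
    by (simp add: a_def column_def real_matrix_def)
  have ua: "u \<bullet> a j = (\<Sum>i\<in>?R. u $ i * A $ i $ j)" for j
    by (simp add: inner_vec_def a) (rule sum.mono_neutral_right, auto)
  have "inj f"
  proof (rule injI, rule ccontr)
    fix k l assume "f k = f l" "k \<noteq> l"
    then have "det ?B = 0" by (intro det_identical_columns[of k l]) (auto simp: column_def)
    then show False using d by simp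
  qed
  have w1: "1 \<le> w j" if "j \<in> ?T" for j
  proof -
    have "\<exists>i\<in>?R. A $ i $ j \<noteq> 0"
    proof (rule ccontr)
      assume "\<not> (\<exists>i\<in>?R. A $ i $ j \<noteq> 0)"
      then have "u \<bullet> a j = 0" unfolding ua by (intro sum.neutral) auto
      then show False using that by simp
    qed
    then obtain i where i: "i \<in> ?R" "A $ i $ j \<noteq> 0" by blast
    have "\<bar>A $ i $ j\<bar> \<le> w j" unfolding w_def using i(1) by (intro member_le_sum) auto
    then show ?thesis using i(2) by linarith
  qed
  have w2: "2 \<le> w (f k)" if k: "k \<in> ?K - {p}" for k
  proof -
    obtain i where i: "i \<in> ?R" "A $ i $ f k \<noteq> 0" using k by (auto simp: a)
    have "\<exists>i'\<in>?R - {i}. A $ i' $ f k \<noteq> 0"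
    proof (rule ccontr)
      assume "\<not> (\<exists>i'\<in>?R - {i}. A $ i' $ f k \<noteq> 0)"
      then have "(\<Sum>i\<in>?R - {i}. u $ i * A $ i $ f k) = 0" by (intro sum.neutral) auto
      then have "u \<bullet> a (f k) = u $ i * A $ i $ f k"
        unfolding ua using i(1) by (subst sum.remove[of ?R i]) auto
      then show False using f[of k] k i by simp
    qed
    then obtain i' where i': "i' \<in> ?R - {i}" "A $ i' $ f k \<noteq> 0" by blast
    have "\<bar>A $ i $ f k\<bar> + \<bar>A $ i' $ f k\<bar> = (\<Sum>l\<in>{i, i'}. \<bar>A $ l $ f k\<bar>)" using i' by auto
    also have "\<dots> \<le> w (f k)" unfolding w_def using i i' by (intro sum_mono2) auto
    finally show ?thesis using i(2) i'(2) by linarith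
  qed
  \<comment> \<open>The two column sets are disjoint because \<open>u\<close> vanishes on the
    second, so their weights add up to at most the total of the rows in \<open>?R\<close>.\<close>
  have "int (card ?T) + 2 * int (card (?K - {p})) = (\<Sum>j\<in>?T. 1) + (\<Sum>j\<in>f ` (?K - {p}). 2)"
    using \<open>inj f\<close> by (simp add: card_image inj_on_def)
  also have "\<dots> \<le> (\<Sum>j\<in>?T. w j) + (\<Sum>j\<in>f ` (?K - {p}). w j)"
    using w1 w2 by (intro add_mono sum_mono) auto
  also have "\<dots> = (\<Sum>j\<in>?T \<union> f ` (?K - {p}). w j)"
    using f by (intro sum.union_disjoint[symmetric]) auto
  also have "\<dots> \<le> (\<Sum>j\<in>UNIV. w j)"
    by (intro sum_mono2) (auto simp: w_def sum_nonneg)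
  also have "\<dots> = (\<Sum>i\<in>?R. \<Sum>j\<in>UNIV. \<bar>A $ i $ j\<bar>)" unfolding w_def by (rule sum.swap)
  also have "\<dots> \<le> int (card ?R) * S" using sum_bounded_above[of ?R _ S] S by simp
  finally have "int (card ?T) + 2 * int (card (?K - {p})) \<le> int (card ?R) * S" .
  \<comment> \<open>Leaving out \<open>p\<close> loses at most one column of weight 2, whence the
    \<open>+ 2\<close> in the conclusion.\<close>
  moreover have "card ?K \<le> card (insert p (?K - {p}))" by (intro card_mono) auto
  then have "card ?K \<le> card (?K - {p}) + 1" by (subst (asm) card_insert_disjoint) auto
  then have "card ?R \<le> card (?K - {p}) + 1" using card_support_le[OF d, of ?R] by linarith
  ultimately show ?thesis by linarith
qed

section \<open>The semigroup and its saturation\<close>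

lemma real_matrix_mult_vec:
  "real_matrix A *v l = (\<Sum>j\<in>UNIV. l $ j *\<^sub>R column j (real_matrix A))"
  unfolding matrix_mult_sum scalar_mult_eq_scaleR ..

lemma column_real_matrix: "column j (real_matrix A) $ i = real_of_int (A $ i $ j)"
  by (simp add: column_def real_matrix_def)

lemma semigroup_of_iff:
  "x \<in> semigroup_of A \<longleftrightarrow> (\<exists>c. x = (\<Sum>j\<in>UNIV. real (c j) *\<^sub>R column j (real_matrix A)))"
proof
  assume "x \<in> semigroup_of A"
  then obtain l where l: "x = real_matrix A *v l" "\<forall>j. l $ j \<in> \<nat>"
    by (auto simp: semigroup_of_def)
  have "\<exists>n. l $ j = real n" for j using l(2) by (meson Nats_cases)
  then obtain c where "\<And>j. l $ j = real (c j)" by metis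
  then have "x = (\<Sum>j\<in>UNIV. real (c j) *\<^sub>R column j (real_matrix A))"
    unfolding l(1) real_matrix_mult_vec by simp
  then show "\<exists>c. x = (\<Sum>j\<in>UNIV. real (c j) *\<^sub>R column j (real_matrix A))"
    by (intro exI[of _ c])
next
  assume "\<exists>c. x = (\<Sum>j\<in>UNIV. real (c j) *\<^sub>R column j (real_matrix A))"
  then obtain c where "x = (\<Sum>j\<in>UNIV. real (c j) *\<^sub>R column j (real_matrix A))" by (elim exE)
  then have "x = real_matrix A *v (\<chi> j. real (c j))" by (simp add: real_matrix_mult_vec)
  then show "x \<in> semigroup_of A" unfolding semigroup_of_def by fastforce
qed

lemma semigroup_of_add:
  assumes "x \<in> semigroup_of A" "y \<in> semigroup_of A"
  shows "x + y \<in> semigroup_of A"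
proof -
  obtain c d where "x = (\<Sum>j\<in>UNIV. real (c j) *\<^sub>R column j (real_matrix A))"
    "y = (\<Sum>j\<in>UNIV. real (d j) *\<^sub>R column j (real_matrix A))"
    using assms unfolding semigroup_of_iff by blast
  then show ?thesis
    unfolding semigroup_of_iff
    by (intro exI[of _ "\<lambda>j. c j + d j"]) (simp add: scaleR_add_left sum.distrib)
qed

lemma column_in_semigroup_of: "real n *\<^sub>R column j (real_matrix A) \<in> semigroup_of A"
proof -
  have "real n *\<^sub>R column j (real_matrix A)
      = (\<Sum>k\<in>UNIV. real (if k = j then n else 0) *\<^sub>R column k (real_matrix A))"
    by (subst sum.remove[of UNIV j]) auto
  then show ?thesis
    unfolding semigroup_of_iff by (intro exI[of _ "\<lambda>k. if k = j then n else 0"])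
qed

lemma lattice_of_diff:
  assumes "x \<in> lattice_of A" "y \<in> lattice_of A"
  shows "x - y \<in> lattice_of A"
proof -
  obtain l m where lm: "x = real_matrix A *v l" "\<forall>j. l $ j \<in> \<int>"
    "y = real_matrix A *v m" "\<forall>j. m $ j \<in> \<int>"
    using assms unfolding lattice_of_def by blast
  then have "x - y = real_matrix A *v (l - m)" by (simp add: matrix_vector_mult_diff_distrib)
  moreover have "\<forall>j. (l - m) $ j \<in> \<int>" using lm by simp
  ultimately show ?thesis unfolding lattice_of_def by blast
qed

lemma semigroup_of_subset_lattice_of: "semigroup_of A \<subseteq> lattice_of A"
  unfolding semigroup_of_def lattice_of_def using Nats_subset_Ints by blast

lemma lattice_of_add:
  assumes "x \<in> lattice_of A" "y \<in> lattice_of A"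
  shows "x + y \<in> lattice_of A"
proof -
  have "0 \<in> lattice_of A" unfolding lattice_of_def by (intro CollectI exI[of _ 0]) simp
  then show ?thesis
    using lattice_of_diff[OF assms(1) lattice_of_diff[of 0 A y]] assms(2) by simp
qed

lemma cone_of_eq_hull: "cone_of A = convex_cone hull (range (\<lambda>j. column j (real_matrix A)))"
proof (intro equalityI subsetI)
  fix x assume "x \<in> cone_of A"
  then obtain l where "x = (\<Sum>j\<in>UNIV. l $ j *\<^sub>R column j (real_matrix A))" "\<forall>j. 0 \<le> l $ j"
    unfolding cone_of_def real_matrix_mult_vec by blast
  then show "x \<in> convex_cone hull (range (\<lambda>j. column j (real_matrix A)))"
    unfolding convex_cone_hull_image[OF finite] by (intro exI[of _ "\<lambda>j. l $ j"]) simp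
next
  fix x assume "x \<in> convex_cone hull (range (\<lambda>j. column j (real_matrix A)))"
  then obtain c where c: "\<forall>j. 0 \<le> c j" "x = (\<Sum>j\<in>UNIV. c j *\<^sub>R column j (real_matrix A))"
    unfolding convex_cone_hull_image[OF finite] by blast
  then have "x = real_matrix A *v (\<chi> j. c j)" by (simp add: real_matrix_mult_vec)
  then show "x \<in> cone_of A" unfolding cone_of_def using c(1) by fastforce
qed

section \<open>Maximal minors and row sums of the integer matrix\<close>

lemma det_real_column_submatrix:
  "det (\<chi> i k. column (f k) (real_matrix A) $ i) = real_of_int (det (column_submatrix A f))"
  by (simp add: det_def column_submatrix_def column_real_matrix)

text \<open>A column exchange can produce a repeated column, so \<open>g\<close> may fail to be
  injective. Its minor is then 0, and the nonzero minor of \<open>f\<close> shows that the maximum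
  is over a nonempty set and is not negative.\<close>

lemma abs_minor_le_max_minor:
  fixes A :: "int ^ 'n ^ 'd"
  assumes "det (column_submatrix A f) \<noteq> 0"
  shows "\<bar>det (column_submatrix A g)\<bar> \<le> max_minor A"
proof -
  have inj: "inj h" if "det (column_submatrix A h) \<noteq> 0" for h
  proof (rule injI, rule ccontr)
    fix k l assume "h k = h l" "k \<noteq> l"
    then have "det (column_submatrix A h) = 0"
      by (intro det_identical_columns[of k l]) (auto simp: column_def column_submatrix_def)
    then show False using that by simp
  qed
  have fin: "finite {\<bar>det (column_submatrix A f)\<bar> | f. inj f}" by simp
  have le: "\<bar>det (column_submatrix A h)\<bar> \<le> max_minor A" if "det (column_submatrix A h) \<noteq> 0" for h
    unfolding max_minor_def using inj[OF that] by (intro Max_ge fin) auto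
  show ?thesis
  proof (cases "det (column_submatrix A g) = 0")
    case True
    then show ?thesis using le[OF assms] by simp
  next
    case False
    then show ?thesis by (rule le)
  qed
qed

lemma row_sum_le_M_F:
  fixes A :: "int ^ 'n ^ 'd"
  shows "(\<Sum>j\<in>UNIV. \<bar>A $ i $ j\<bar>) \<le> M_F A + 1"
proof -
  have "finite {\<Sum>j\<in>UNIV. \<bar>A $ i $ j\<bar> | i. True}"
    using finite_imageI[of UNIV "\<lambda>i. \<Sum>j\<in>UNIV. \<bar>A $ i $ j\<bar>"] by (simp add: full_SetCompr_eq)
  then have "(\<Sum>j\<in>UNIV. \<bar>A $ i $ j\<bar>) \<le> Max {\<Sum>j\<in>UNIV. \<bar>A $ i $ j\<bar> | i. True}"
    by (rule Max_ge) auto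
  then show ?thesis by (simp add: M_F_def)
qed

lemma M_F_nonneg:
  fixes A :: "int ^ 'n ^ 'd"
  assumes "A $ i $ j \<noteq> 0"
  shows "0 \<le> M_F A"
proof -
  have "\<bar>A $ i $ j\<bar> \<le> (\<Sum>j\<in>UNIV. \<bar>A $ i $ j\<bar>)" by (intro member_le_sum) auto
  then show ?thesis using row_sum_le_M_F[of A i] assms by linarith
qed

section \<open>Moving a hole into the semigroup along an extreme ray\<close>

text \<open>For positive \<open>M\<close>, replacing \<open>r\<close> by \<open>d\<close> leaves the
  slack \<open>M * (M - 1) + (d - 1)\<close>. For \<open>M = 0\<close> that replacement goes the
  wrong way, but \<open>1 \<le> r\<close> already forces \<open>t \<le> 0\<close>.\<close>

lemma linear_times_succ_le_square:
  fixes t r d M :: int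
  assumes "t \<le> r * (M - 1) + 1" "1 \<le> r" "r \<le> d" "0 \<le> M"
  shows "t * (M + 1) \<le> (d + 1) * M\<^sup>2"
proof (cases "M = 0")
  case False
  then have "r * (M - 1) \<le> d * (M - 1)" using assms by (intro mult_right_mono) auto
  then have "t * (M + 1) \<le> (d * (M - 1) + 1) * (M + 1)" using assms by (intro mult_right_mono) auto
  also have "\<dots> = (d + 1) * M\<^sup>2 - (M * (M - 1) + (d - 1))" by (simp add: algebra_simps power2_eq_square)
  also have "\<dots> \<le> (d + 1) * M\<^sup>2"
    using False assms mult_nonneg_nonneg[of M "M - 1"] by linarith
  finally show ?thesis .
qed (use assms in simp)

text \<open>The bound on \<open>N\<close> carries the factor \<open>M_F A + 1\<close>, the bound on
  row sums, because passing from coefficients to entries of a hole costs exactly this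
  factor.\<close>

lemma translate_into_semigroup:
  fixes A :: "int ^ 'n ^ 'd"
  defines "a \<equiv> \<lambda>j. column j (real_matrix A)"
  assumes span: "span (range a) = UNIV"
    and ext: "a j0 \<notin> convex_cone hull (a ` {k. \<not> (\<exists>t>0. a k = t *\<^sub>R a j0)})"
    and x: "x = (\<Sum>j\<in>UNIV. \<nu> j *\<^sub>R a j)" "\<And>j. 0 \<le> \<nu> j" "\<And>j. \<nu> j \<le> 1"
    and xQ: "x \<notin> semigroup_of A"
    and ex: "x + real n *\<^sub>R a j0 \<in> semigroup_of A"
  obtains N where "x + real N *\<^sub>R a j0 \<in> semigroup_of A"
    "int N * (M_F A + 1) \<le> (int CARD('d) + 1) * (M_F A)\<^sup>2 * max_minor A"
proof -
  define K where "K = {k. \<not> (\<exists>t>0. a k = t *\<^sub>R a j0)}"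
  define D where "D = max_minor A"
  have "a k \<in> span {a j0}" if "k \<notin> K" for k
    using that span_scale[OF span_base[of "a j0" "{a j0}"]] by (auto simp: K_def)
  then obtain u where u: "u \<bullet> a j0 = 1" "\<And>k. k \<in> K \<Longrightarrow> u \<bullet> a k \<le> 0"
    "span (insert (a j0) (a ` {k \<in> K. u \<bullet> a k = 0})) = UNIV"
    using separation_vertex[OF span, of K "a j0"] ext unfolding K_def[symmetric] by blast
  have "a j0 \<noteq> 0" using u(1) by auto
  then obtain f k0 where f: "f k0 = j0" "\<And>k. k \<noteq> k0 \<Longrightarrow> f k \<in> {k \<in> K. u \<bullet> a k = 0}"
    and d: "det (\<chi> i k. a (f k) $ i) \<noteq> 0"
    using spanning_family_basis[OF u(3)] by blast
  \<comment> \<open>Common denominator of the values of \<open>u\<close> on the columns;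
    \<open>m j\<close> is the numerator of \<open>\<bar>u \<bullet> a j\<bar>\<close>, obtained by
    putting column \<open>j\<close> in the place of \<open>j0\<close>.\<close>
  define \<delta> where "\<delta> = nat \<bar>det (column_submatrix A f)\<bar>"
  define m where "m j = nat \<bar>det (column_submatrix A (f(k0 := j)))\<bar>" for j
  have det_nz: "det (column_submatrix A f) \<noteq> 0"
    using d by (simp add: a_def det_real_column_submatrix)
  then have \<delta>: "1 \<le> \<delta>" by (simp add: \<delta>_def)
  have mD: "int (m j) \<le> D" for j
    using abs_minor_le_max_minor[OF det_nz] by (simp add: m_def D_def)
  have D: "1 \<le> D" using abs_minor_le_max_minor[OF det_nz, of f] \<delta> by (simp add: \<delta>_def D_def)
  have m: "real (m j) = \<bar>u \<bullet> a j\<bar> * real \<delta>" for j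
  proof -
    have "det (\<chi> i k. a ((f(k0 := j)) k) $ i) = (u \<bullet> a j) * det (\<chi> i k. a (f k) $ i)"
      using u(1) f d by (intro det_replace_column) auto
    then have "real_of_int (det (column_submatrix A (f(k0 := j)))) = (u \<bullet> a j) * real_of_int (det (column_submatrix A f))"
      unfolding a_def det_real_column_submatrix .
    then have "\<bar>real_of_int (det (column_submatrix A (f(k0 := j))))\<bar> = \<bar>u \<bullet> a j\<bar> * \<bar>real_of_int (det (column_submatrix A f))\<bar>"
      by (simp add: abs_mult)
    then show ?thesis by (simp add: m_def \<delta>_def)
  qed
  let ?P = "\<lambda>N. x + real N *\<^sub>R a j0 \<in> semigroup_of A"
  define N where "N = (LEAST N. ?P N)"
  have PN: "?P N" unfolding N_def by (rule LeastI[of ?P, OF ex])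
  have min: "\<not> ?P N'" if "N' < N" for N' using that unfolding N_def by (rule not_less_Least)
  obtain l where l: "x + real N *\<^sub>R a j0 = (\<Sum>j\<in>UNIV. real (l j) *\<^sub>R a j)"
    using PN unfolding semigroup_of_iff a_def by blast
  \<comment> \<open>Otherwise \<open>s\<close> copies of \<open>a j\<close> could be traded for \<open>p\<close> copies of \<open>a j0\<close>, contradicting minimality.\<close>
  have exchange: "l j < s" if s: "real s *\<^sub>R a j = real p *\<^sub>R a j0" and p: "1 \<le> p" for j s p
  proof (rule ccontr)
    assume "\<not> l j < s"
    then have ls: "s \<le> l j" by simp
    define y where "y = (\<Sum>i\<in>UNIV. real ((l(j := l j - s)) i) *\<^sub>R a i)"
    have yQ: "y \<in> semigroup_of A" unfolding semigroup_of_iff y_def a_def by (rule exI) (rule refl)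
    have "(\<Sum>i\<in>UNIV. real (l i) *\<^sub>R a i) = real s *\<^sub>R a j + y"
      using ls by (simp add: y_def sum.remove[of UNIV j] of_nat_diff algebra_simps)
    then have xy: "x + real N *\<^sub>R a j0 = real p *\<^sub>R a j0 + y" using l s by simp
    \<comment> \<open>If \<open>p\<close> exceeds \<open>N\<close>, no smaller multiple is available
      to contradict minimality; then \<open>x\<close> itself would lie in the semigroup.\<close>
    show False
    proof (cases "p \<le> N")
      case True
      then have "x + real (N - p) *\<^sub>R a j0 = y" using xy by (simp add: of_nat_diff algebra_simps)
      then show False using min[of "N - p"] yQ p True by simp
    next
      case False
      then have "x = real (p - N) *\<^sub>R a j0 + y" using xy by (simp add: of_nat_diff algebra_simps)
      then show False
        using xQ yQ column_in_semigroup_of[of "p - N" j0 A] semigroup_of_add unfolding a_def by metis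
    qed
  qed
  let ?T = "{j. u \<bullet> a j \<noteq> 0}"
  \<comment> \<open>Off the ray, \<open>u\<close> is nonpositive and only
    \<open>\<nu> j * \<bar>u \<bullet> a j\<bar>\<close> can contribute. On the ray,
    \<open>\<delta>\<close> copies of \<open>a j\<close> equal \<open>m j\<close> copies of
    \<open>a j0\<close>, so \<open>exchange\<close> gives \<open>l j < \<delta>\<close>. Either way
    the contribution is at most \<open>m j\<close>.\<close>
  have bound: "(real (l j) - \<nu> j) * (u \<bullet> a j) \<le> real_of_int D" for j
  proof (cases "j \<in> K")
    case True
    have "(real (l j) - \<nu> j) * (u \<bullet> a j) = real (l j) * (u \<bullet> a j) + \<nu> j * \<bar>u \<bullet> a j\<bar>"
      using u(2)[OF True] by (simp add: algebra_simps)
    also have "real (l j) * (u \<bullet> a j) \<le> 0" using u(2)[OF True] by (intro mult_nonneg_nonpos) auto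
    also have "\<nu> j * \<bar>u \<bullet> a j\<bar> \<le> 1 * \<bar>u \<bullet> a j\<bar>" using x(3) by (intro mult_right_mono) auto
    also have "1 * \<bar>u \<bullet> a j\<bar> \<le> real \<delta> * \<bar>u \<bullet> a j\<bar>" using \<delta> by (intro mult_right_mono) auto
    also have "\<dots> = real (m j)" using m by simp
    finally show ?thesis using mD[of j] by linarith
  next
    case False
    then obtain t where t: "t > 0" "a j = t *\<^sub>R a j0" by (auto simp: K_def)
    have ut: "u \<bullet> a j = t" using t u(1) by simp
    have mt: "real (m j) = t * real \<delta>" using m[of j] ut t by simp
    have "real \<delta> *\<^sub>R a j = real (m j) *\<^sub>R a j0" using t mt by simp
    moreover have "0 < real (m j)" unfolding mt using t \<delta> by simp
    then have "1 \<le> m j" by simp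
    ultimately have "l j < \<delta>" by (rule exchange)
    have "(real (l j) - \<nu> j) * (u \<bullet> a j) \<le> real \<delta> * t"
      unfolding ut using \<open>l j < \<delta>\<close> x(2)[of j] t by (intro mult_right_mono) auto
    then show ?thesis using mt mD[of j] by (simp add: mult.commute)
  qed
  \<comment> \<open>A minimal \<open>N\<close> leaves no copy of \<open>a j0\<close> in the
    representation, so \<open>j0\<close> drops out of the count and only
    \<open>card (?T - {j0})\<close> columns remain.\<close>
  have "l j0 < 1" using exchange[of 1 j0 1] by simp
  then have bound0: "(real (l j0) - \<nu> j0) * (u \<bullet> a j0) \<le> 0" using x(2) u(1) by simp
  have j0T: "j0 \<in> ?T" using u(1) by simp
  have "u \<bullet> (x + real N *\<^sub>R a j0) = (\<Sum>j\<in>UNIV. real (l j) * (u \<bullet> a j))"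
    unfolding l by (simp add: inner_sum_right)
  moreover have "u \<bullet> x = (\<Sum>j\<in>UNIV. \<nu> j * (u \<bullet> a j))"
    unfolding x(1) by (simp add: inner_sum_right)
  ultimately have "real N = (\<Sum>j\<in>UNIV. (real (l j) - \<nu> j) * (u \<bullet> a j))"
    using u(1) by (simp add: inner_add_right left_diff_distrib sum_subtractf)
  also have "\<dots> = (\<Sum>j\<in>?T. (real (l j) - \<nu> j) * (u \<bullet> a j))"
    by (rule sum.mono_neutral_right) auto
  also have "\<dots> = (real (l j0) - \<nu> j0) * (u \<bullet> a j0) + (\<Sum>j\<in>?T - {j0}. (real (l j) - \<nu> j) * (u \<bullet> a j))"
    using j0T by (intro sum.remove) auto
  also have "\<dots> \<le> 0 + (\<Sum>j\<in>?T - {j0}. real_of_int D)"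
    using bound bound0 by (intro add_mono sum_mono) auto
  also have "\<dots> = real (card (?T - {j0})) * real_of_int D" by simp
  finally have "real N \<le> real_of_int (int (card (?T - {j0})) * D)" by simp
  then have ND: "int N \<le> int (card (?T - {j0})) * D" by (metis of_int_le_iff of_int_of_nat_eq)
  define r where "r = int (card {i. u $ i \<noteq> 0})"
  have "u \<noteq> 0" using u(1) by auto
  then have "{i. u $ i \<noteq> 0} \<noteq> {}" by (auto simp: vec_eq_iff)
  then have "card {i. u $ i \<noteq> 0} > 0" by (simp only: card_gt_0_iff finite simp_thms)
  then have r1: "1 \<le> r" unfolding r_def by linarith
  have rd: "r \<le> int CARD('d)" by (simp add: r_def card_mono)
  obtain i where "a j0 $ i \<noteq> 0" using \<open>a j0 \<noteq> 0\<close> by (auto simp: vec_eq_iff)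
  then have M0: "0 \<le> M_F A" using M_F_nonneg by (simp add: a_def column_real_matrix)
  have "int (card ?T) + 2 * r \<le> r * (M_F A + 1) + 2"
    unfolding r_def a_def
    by (rule card_nonorthogonal_columns[OF row_sum_le_M_F, where f = f and p = k0])
      (use f(2) d in \<open>auto simp: a_def\<close>)
  moreover have "int (card ?T) = int (card (?T - {j0})) + 1"
    using card.remove[of ?T j0] j0T by simp
  ultimately have "int (card (?T - {j0})) \<le> r * (M_F A - 1) + 1" by (simp add: algebra_simps)
  then have quad: "int (card (?T - {j0})) * (M_F A + 1) \<le> (int CARD('d) + 1) * (M_F A)\<^sup>2"
    using r1 rd M0 by (rule linear_times_succ_le_square)
  have "int N * (M_F A + 1) \<le> (int (card (?T - {j0})) * D) * (M_F A + 1)"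
    using ND M0 by (intro mult_right_mono) auto
  also have "\<dots> = (int (card (?T - {j0})) * (M_F A + 1)) * D" by simp
  also have "\<dots> \<le> ((int CARD('d) + 1) * (M_F A)\<^sup>2) * D" using quad D by (intro mult_right_mono) auto
  finally show thesis using that[OF PN] by (simp add: D_def)
qed

text \<open>The translates are pairwise distinct and stay in the saturation, so finitely many holes
  cannot exhaust them.\<close>

lemma hole_translate_ex:
  fixes A :: "int ^ 'n ^ 'd"
  assumes "finite (holes A)" "x \<in> saturation A" "column j (real_matrix A) \<noteq> 0"
  obtains n where "x + real n *\<^sub>R column j (real_matrix A) \<in> semigroup_of A"
proof -
  let ?g = "\<lambda>n. x + real n *\<^sub>R column j (real_matrix A)"
  have "inj ?g" using assms(3) by (auto simp: inj_def)
  then have "infinite (range ?g)" by (simp add: finite_image_iff)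
  then have "\<not> range ?g \<subseteq> holes A" using assms(1) finite_subset by blast
  then obtain n where n: "?g n \<notin> holes A" by blast
  have "column j (real_matrix A) \<in> cone_of A"
    unfolding cone_of_eq_hull by (intro hull_inc) auto
  then have "?g n \<in> cone_of A"
    using assms(2) unfolding saturation_def cone_of_eq_hull
    by (intro convex_cone_add convex_cone_scaleR convex_cone_convex_cone_hull) auto
  moreover have "?g n \<in> lattice_of A"
    using assms(2) subsetD[OF semigroup_of_subset_lattice_of column_in_semigroup_of]
    unfolding saturation_def by (intro lattice_of_add) auto
  ultimately show thesis using n that unfolding holes_def saturation_def by blast
qed

section \<open>From coefficients on extreme rays to the entries of a hole\<close>

theorem theorem6p1:
  fixes A :: "int ^ 'n ^ 'd"
  assumes "rank (real_matrix A) = CARD('d)"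
    and "pointed (cone_of A)"
    and "finite (holes A)"
  shows "\<forall>h\<in>holes A. infnorm h \<le>
    (real CARD('d) + 1) * (real_of_int (M_F A))\<^sup>2 * real_of_int (max_minor A)"
proof
  fix h assume h: "h \<in> holes A"
  define a where "a = (\<lambda>j. column j (real_matrix A))"
  define B where "B = (int CARD('d) + 1) * (M_F A)\<^sup>2 * max_minor A"
  have hQ: "h \<notin> semigroup_of A" and hC: "h \<in> cone_of A" and hL: "h \<in> lattice_of A"
    using h by (auto simp: holes_def saturation_def)
  have "y \<in> span (range a)" for y
  proof -
    have "surj ((*v) (real_matrix A))" using assms(1) by (simp add: full_rank_surjective)
    then obtain l where "y = real_matrix A *v l" by (metis surjD)
    then show ?thesis
      unfolding real_matrix_mult_vec a_def
      by (simp only:) (intro span_sum span_scale span_base rangeI)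
  qed
  then have span: "span (range a) = UNIV" by auto
  obtain J where J: "convex_cone hull (a ` J) = convex_cone hull (range a)"
    and ext: "\<And>j. j \<in> J \<Longrightarrow> a j \<notin> convex_cone hull (a ` {k. \<not> (\<exists>t>0. a k = t *\<^sub>R a j)})"
    using pointed_cone_extreme_generators[of a] assms(2) by (auto simp: cone_of_eq_hull a_def)
  have "h \<in> convex_cone hull (a ` J)" using hC J by (simp add: cone_of_eq_hull a_def)
  then obtain c' where c': "\<forall>j. 0 \<le> c' j" "h = (\<Sum>j\<in>J. c' j *\<^sub>R a j)"
    by (auto simp: convex_cone_hull_image)
  \<comment> \<open>Extension by zero lets all sums run over all columns, the form that
    \<open>translate_into_semigroup\<close> expects for \<open>x\<close>.\<close>
  define c where "c j = (if j \<in> J then c' j else 0)" for j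
  have c: "\<And>j. 0 \<le> c j" "\<And>j. j \<notin> J \<Longrightarrow> c j = 0" using c'(1) by (auto simp: c_def)
  have hc: "h = (\<Sum>j\<in>UNIV. c j *\<^sub>R a j)"
    unfolding c'(2) by (rule sum.mono_neutral_cong_left) (auto simp: c_def)
  define q where "q = (\<Sum>j\<in>UNIV. real (nat \<lfloor>c j\<rfloor>) *\<^sub>R a j)"
  define x where "x = (\<Sum>j\<in>UNIV. frac (c j) *\<^sub>R a j)"
  have floor: "real (nat \<lfloor>c j\<rfloor>) = c j - frac (c j)" for j using c(1)[of j] by (simp add: frac_def)
  have hxq: "h = x + q"
    by (simp add: hc x_def q_def floor scaleR_diff_left sum_subtractf)
  have qQ: "q \<in> semigroup_of A" unfolding q_def semigroup_of_iff a_def by (rule exI) (rule refl)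
  have xQ: "x \<notin> semigroup_of A" using hQ hxq qQ semigroup_of_add by metis
  have "x = h - q" using hxq by simp
  then have xL: "x \<in> lattice_of A"
    using hL qQ semigroup_of_subset_lattice_of lattice_of_diff by blast
  have "x \<in> cone_of A"
    unfolding cone_of_eq_hull convex_cone_hull_image[OF finite] x_def a_def
    by (intro exI[of _ "\<lambda>j. frac (c j)"]) auto
  then have xS: "x \<in> saturation A" using xL by (simp add: saturation_def)
  have cB: "c j * real_of_int (M_F A + 1) \<le> real_of_int B" if M: "0 \<le> M_F A" and j: "j \<in> J" for j
  proof -
    have "a j \<noteq> 0"
    proof
      assume "a j = 0"
      then have "a j \<in> convex_cone hull (a ` {k. \<not> (\<exists>t>0. a k = t *\<^sub>R a j)})"
        by (simp only: convex_cone_hull_contains_0)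
      then show False using ext[OF j] by contradiction
    qed
    then obtain n where n: "x + real n *\<^sub>R a j \<in> semigroup_of A"
      unfolding a_def by (rule hole_translate_ex[OF assms(3) xS])
    have \<nu>: "x = (\<Sum>j\<in>UNIV. frac (c j) *\<^sub>R column j (real_matrix A))"
      by (simp only: x_def a_def)
    obtain N where N: "x + real N *\<^sub>R a j \<in> semigroup_of A" "int N * (M_F A + 1) \<le> B"
      using translate_into_semigroup[OF span[unfolded a_def] ext[OF j, unfolded a_def] \<nu>
          frac_ge_0 less_imp_le[OF frac_lt_1] xQ n[unfolded a_def]]
      unfolding a_def B_def by blast
    have "nat \<lfloor>c j\<rfloor> < N"
    proof (rule ccontr)
      assume le: "\<not> nat \<lfloor>c j\<rfloor> < N"
      \<comment> \<open>Moving \<open>N\<close> copies of \<open>a j\<close> from \<open>q\<close>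
        to \<open>x\<close> splits \<open>h\<close> into two semigroup elements.\<close>
      define p where "p = (\<lambda>i. nat \<lfloor>c i\<rfloor>)(j := nat \<lfloor>c j\<rfloor> - N)"
      define z where "z = (\<Sum>i\<in>UNIV. real (p i) *\<^sub>R a i)"
      have "q = real N *\<^sub>R a j + z"
        using le unfolding q_def z_def p_def
        by (simp add: sum.remove[of UNIV j] of_nat_diff algebra_simps)
      then have "h = (x + real N *\<^sub>R a j) + z" unfolding hxq by simp
      moreover have "z \<in> semigroup_of A"
        unfolding semigroup_of_iff z_def a_def by (rule exI) (rule refl)
      ultimately have "h \<in> semigroup_of A" using semigroup_of_add[OF N(1)] by simp
      then show False using hQ by contradiction
    qed
    then have "c j \<le> real N" using floor[of j] frac_lt_1[of "c j"] by linarith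
    then have "c j * real_of_int (M_F A + 1) \<le> real N * real_of_int (M_F A + 1)"
      using M by (intro mult_right_mono) auto
    also have "\<dots> = real_of_int (int N * (M_F A + 1))" by simp
    also have "\<dots> \<le> real_of_int B" using N(2) by (simp only: of_int_le_iff)
    finally show ?thesis .
  qed
  \<comment> \<open>A nonzero hole needs a nonzero column with index in \<open>J\<close>. This gives
    \<open>0 \<le> M_F A\<close> and then \<open>0 \<le> B\<close>, which covers the indices outside
    \<open>J\<close>, where \<open>c\<close> is 0.\<close>
  have "h \<noteq> 0" using hQ column_in_semigroup_of[of 0 _ A] by auto
  then obtain j0 where "c j0 \<noteq> 0" "a j0 \<noteq> 0" unfolding hc by (metis (no_types, lifting) scale_eq_0_iff sum.neutral)
  then obtain i0 where "A $ i0 $ j0 \<noteq> 0" by (auto simp: vec_eq_iff a_def column_real_matrix)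
  then have M: "0 \<le> M_F A" by (rule M_F_nonneg)
  have "j0 \<in> J" using c(2) \<open>c j0 \<noteq> 0\<close> by blast
  have B0: "0 \<le> real_of_int B"
    using cB[OF M \<open>j0 \<in> J\<close>] c(1)[of j0] M by (meson add_nonneg_nonneg mult_nonneg_nonneg of_int_0_le_iff order_trans zero_le_one)
  have "\<bar>h $ i\<bar> \<le> real_of_int B" for i
  proof -
    have "\<bar>h $ i\<bar> \<le> (\<Sum>j\<in>UNIV. c j * \<bar>real_of_int (A $ i $ j)\<bar>)"
      unfolding hc using c(1)
      by (auto simp: a_def column_real_matrix abs_mult intro!: order_trans[OF sum_abs] sum_mono)
    \<comment> \<open>The factor feeds \<open>cB\<close> in each summand; the row sum that remains
      is at most the same factor, which then cancels.\<close>
    then have "\<bar>h $ i\<bar> * real_of_int (M_F A + 1) \<le> (\<Sum>j\<in>UNIV. c j * \<bar>real_of_int (A $ i $ j)\<bar>) * real_of_int (M_F A + 1)"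
      using M by (intro mult_right_mono) auto
    also have "\<dots> = (\<Sum>j\<in>UNIV. (c j * real_of_int (M_F A + 1)) * \<bar>real_of_int (A $ i $ j)\<bar>)"
      unfolding sum_distrib_right by (intro sum.cong refl) (simp only: mult_ac)
    also have "\<dots> \<le> (\<Sum>j\<in>UNIV. real_of_int B * \<bar>real_of_int (A $ i $ j)\<bar>)"
    proof (intro sum_mono mult_right_mono)
      show "c j * real_of_int (M_F A + 1) \<le> real_of_int B" for j
        using cB[OF M] c(2) B0 by (cases "j \<in> J") auto
    qed auto
    also have "\<dots> = real_of_int B * real_of_int (\<Sum>j\<in>UNIV. \<bar>A $ i $ j\<bar>)"
      by (simp add: sum_distrib_left)
    also have "\<dots> \<le> real_of_int B * real_of_int (M_F A + 1)"
      using row_sum_le_M_F[of A i] B0 by (intro mult_left_mono) (simp_all only: of_int_le_iff)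
    finally show ?thesis using M by (simp add: mult_le_cancel_right)
  qed
  then have "infnorm h \<le> real_of_int B"
    unfolding infnorm_cart by (intro cSup_least) auto
  then show "infnorm h \<le> (real CARD('d) + 1) * (real_of_int (M_F A))\<^sup>2 * real_of_int (max_minor A)"
    by (simp add: B_def)
qed

end
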